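(* Let $(X,G)$ be a minimal system. Assume that $n\geq 2$ and that $X\times X$ has a dense set of minimal points. Then $(X,G)$ is blockily thickly $n$-sensitive if and only if there exist a point $x\in X$ and pairwise distinct points $x_1,x_2,\dots,x_n\in Q[x]$ such that $(x_1,x_2,\dots,x_n)$ is a minimal point for $(X^n,G)$.
   Context: Throughout, $G$ is a countable discrete group. A topological dynamical system $(X,G)$ is a (nonempty) compact metric space $X$ with metric $d$ together with a continuous action of $G$ on $X$, written $(g,x)\mapsto gx$. For $n\in\mathbb{N}$, $G$ acts diagonally on $X^n$ by $g(x_1,\dots,x_n)=(gx_1,\dots,gx_n)$. A subsystem is a nonempty closed $G$-invariant subset with the restricted action; a system is minimal if it contains no proper subsystem. A point is a minimal point if it belongs to some minimal subsystem; minimal points of $X\times X$ are taken with respect to the diagonal action. A pair $(x_1,x_2)\in X\times X$ is regionally proximal if for each $\varepsilon>0$ there exist $x_1',x_2'\in X$ with $d(x_i,x_i')<\varepsilon$ for $i=1,2$ and $g\in G$ such that $d(gx_1',gx_2')<\varepsilon$. $Q(X,G)$ is the set of all regionally proximal pairs, and $Q[x]=\{y\in X:(x,y)\in Q(X,G)\}$. For $n\geq 2$, $(X,G)$ is blockily thickly $n$-sensitive if there is a constant $\delta>0$ such that for any finite subset $F$ of $G$ and any nonempty open subset $U$ of $X$ there exist $x_1,\dots,x_n\in U$ and $h\in G$ such that $\min_{1\le i<j\le n}d(ghx_i,ghx_j)>\delta$ for all $g\in F$. *)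

theory Defs
  imports "HOL-Analysis.Analysis" "HOL-Algebra.Group_Action"
begin

text \<open>\<open>G\<close> is discrete, so continuity of the action means that every \<open>\<phi> g\<close> is continuous.
  Being an element of \<open>BijGroup X\<close>, \<open>\<phi> g\<close> is \<open>undefined\<close> outside \<open>X\<close>.\<close>

locale topological_dynamical_system =
  group_action G X \<phi> + Metric_space X d
  for G :: "('g, 'm) monoid_scheme" (structure)
    and X :: "'a set" and d :: "'a \<Rightarrow> 'a \<Rightarrow> real" and \<phi> :: "'g \<Rightarrow> 'a \<Rightarrow> 'a" +
  assumes countable_group: "countable (carrier G)"
    and nonempty: "X \<noteq> {}"
    and compact: "compact_space mtopology"
    and continuous_action: "g \<in> carrier G \<Longrightarrow> continuous_map mtopology mtopology (\<phi> g)"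

text \<open>The next notions take an arbitrary topology \<open>T\<close> as phase space, because they are
  used for the space itself, for its closed invariant subsets, and for its finite powers.\<close>

definition subsystem ::
  "('g, 'm) monoid_scheme \<Rightarrow> 'a topology \<Rightarrow> ('g \<Rightarrow> 'a \<Rightarrow> 'a) \<Rightarrow> 'a set \<Rightarrow> bool" where
  "subsystem G T \<phi> A \<longleftrightarrow>
     A \<noteq> {} \<and> closedin T A \<and> (\<forall>g\<in>carrier G. \<forall>x\<in>A. \<phi> g x \<in> A)"

definition minimal_system ::
  "('g, 'm) monoid_scheme \<Rightarrow> 'a topology \<Rightarrow> ('g \<Rightarrow> 'a \<Rightarrow> 'a) \<Rightarrow> bool" where
  "minimal_system G T \<phi> \<longleftrightarrow> \<not> (\<exists>A. subsystem G T \<phi> A \<and> A \<subset> topspace T)"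

definition minimal_point ::
  "('g, 'm) monoid_scheme \<Rightarrow> 'a topology \<Rightarrow> ('g \<Rightarrow> 'a \<Rightarrow> 'a) \<Rightarrow> 'a \<Rightarrow> bool" where
  "minimal_point G T \<phi> x \<longleftrightarrow>
     (\<exists>A. subsystem G T \<phi> A \<and> minimal_system G (subtopology T A) \<phi> \<and> x \<in> A)"

definition pair_action :: "('g \<Rightarrow> 'a \<Rightarrow> 'a) \<Rightarrow> 'g \<Rightarrow> 'a \<times> 'a \<Rightarrow> 'a \<times> 'a" where
  "pair_action \<phi> g p = (\<phi> g (fst p), \<phi> g (snd p))"

text \<open>An \<open>n\<close>-tuple is an extensional function on \<open>{1..n}\<close>, as in \<open>product_topology\<close>.\<close>

definition power_topology :: "nat \<Rightarrow> 'a topology \<Rightarrow> (nat \<Rightarrow> 'a) topology" where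
  "power_topology n T = product_topology (\<lambda>_. T) {1..n}"

definition power_action :: "nat \<Rightarrow> ('g \<Rightarrow> 'a \<Rightarrow> 'a) \<Rightarrow> 'g \<Rightarrow> (nat \<Rightarrow> 'a) \<Rightarrow> nat \<Rightarrow> 'a" where
  "power_action n \<phi> g xs = (\<lambda>i\<in>{1..n}. \<phi> g (xs i))"

definition regionally_proximal ::
  "('g, 'm) monoid_scheme \<Rightarrow> 'a set \<Rightarrow> ('a \<Rightarrow> 'a \<Rightarrow> real) \<Rightarrow> ('g \<Rightarrow> 'a \<Rightarrow> 'a) \<Rightarrow> ('a \<times> 'a) set"
  where
  "regionally_proximal G X d \<phi> =
     {(x1, x2). x1 \<in> X \<and> x2 \<in> X \<and>
        (\<forall>\<epsilon>>0. \<exists>y1\<in>X. \<exists>y2\<in>X. d x1 y1 < \<epsilon> \<and> d x2 y2 < \<epsilon> \<and>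
           (\<exists>g\<in>carrier G. d (\<phi> g y1) (\<phi> g y2) < \<epsilon>))}"

definition blockily_thickly_sensitive ::
  "nat \<Rightarrow> ('g, 'm) monoid_scheme \<Rightarrow> 'a set \<Rightarrow> ('a \<Rightarrow> 'a \<Rightarrow> real) \<Rightarrow> ('g \<Rightarrow> 'a \<Rightarrow> 'a) \<Rightarrow> bool"
  where
  "blockily_thickly_sensitive n G X d \<phi> \<longleftrightarrow>
     (\<exists>\<delta>>0. \<forall>F U. finite F \<and> F \<subseteq> carrier G \<and>
        openin (Metric_space.mtopology X d) U \<and> U \<noteq> {} \<longrightarrow>
        (\<exists>xs \<in> {1..n} \<rightarrow>\<^sub>E U. \<exists>h\<in>carrier G. \<forall>g\<in>F. \<forall>i\<in>{1..n}. \<forall>j\<in>{1..n}.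
           i < j \<longrightarrow> d (\<phi> (g \<otimes>\<^bsub>G\<^esub> h) (xs i)) (\<phi> (g \<otimes>\<^bsub>G\<^esub> h) (xs j)) > \<delta>))"

end

theory Submission
  imports Defs
begin

text \<open>
  For the forward direction, sensitivity applied to small balls and large finite sets \<open>F\<close> gives, by
  compactness, a tuple whose coordinates are pairwise regionally proximal and stay a fixed distance
  apart along the whole orbit; a minimal set in its orbit closure consists of such tuples.

  For the converse, let \<open>(x_1, \<dots>, x_n)\<close> be a minimal tuple in \<open>Q[x]\<close>. Its coordinates stay apart along
  the orbit, so it suffices to find, for every nonempty open \<open>U\<close> and neighbourhoods \<open>V_i\<close> of \<open>x_i\<close>,
  a single \<open>h\<close> such that \<open>hU\<close> meets every \<open>V_i\<close>. Factor maps from minimal sets onto \<open>X\<close> send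
  nonempty open sets to sets with interior, so there is a nonempty open set of \<open>q\<close> such that \<open>Q[q]\<close> meets all
  \<open>V_i\<close>. The pairs \<open>(q, y_i)\<close> are then replaced one at a time by nearby minimal pairs
  that lie in the same orbit closure as pairs with nearly equal coordinates.
\<close>

section \<open>Minimal sets of compact flows\<close>

text \<open>Minimality phrased inside the ambient topology, so that arguments about minimal sets
  form no subtopologies; \<open>minimal_set_iff\<close> links it to minimality of the restricted
  system.\<close>

definition minimal_set ::
  "('g, 'm) monoid_scheme \<Rightarrow> 'a topology \<Rightarrow> ('g \<Rightarrow> 'a \<Rightarrow> 'a) \<Rightarrow> 'a set \<Rightarrow> bool" where
  "minimal_set G T \<phi> A \<longleftrightarrow>
     subsystem G T \<phi> A \<and> (\<forall>C. subsystem G T \<phi> C \<and> C \<subseteq> A \<longrightarrow> C = A)"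

lemma minimal_set_iff:
  "minimal_set G T \<phi> A \<longleftrightarrow>
     subsystem G T \<phi> A \<and> minimal_system G (subtopology T A) \<phi>"
proof (cases "subsystem G T \<phi> A")
  case True
  then have A: "closedin T A" by (simp add: subsystem_def)
  then have "topspace (subtopology T A) = A"
    by (metis closedin_subset topspace_subtopology_subset)
  moreover have "subsystem G (subtopology T A) \<phi> C \<longleftrightarrow> subsystem G T \<phi> C \<and> C \<subseteq> A" for C
    using A by (auto simp: subsystem_def closedin_closed_subtopology)
  ultimately show ?thesis
    using True unfolding minimal_set_def minimal_system_def by blast
qed (simp add: minimal_set_def)

lemma minimal_point_iff:
  "minimal_point G T \<phi> x \<longleftrightarrow> (\<exists>A. minimal_set G T \<phi> A \<and> x \<in> A)"
  unfolding minimal_point_def minimal_set_iff by blast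

lemma minimal_system_subsystem_eq:
  assumes "minimal_system G T \<phi>" "subsystem G T \<phi> A"
  shows "A = topspace T"
proof -
  have "A \<subseteq> topspace T"
    using assms(2) closedin_subset by (auto simp: subsystem_def)
  then show ?thesis
    using assms unfolding minimal_system_def by blast
qed

section \<open>Preliminaries on compactness, interiors and closed sets\<close>

text \<open>Directedness puts a nonempty member below every finite intersection, which is the finite
  intersection property. It serves both the Zorn argument for minimal sets and the limit over finite
  subsets of the group and \<epsilon>.\<close>

lemma compact_space_directed_Inter:
  assumes "compact_space T" "\<C> \<noteq> {}"
    and "\<And>C. C \<in> \<C> \<Longrightarrow> closedin T C \<and> C \<noteq> {}"
    and "\<And>A B. A \<in> \<C> \<Longrightarrow> B \<in> \<C> \<Longrightarrow> \<exists>C\<in>\<C>. C \<subseteq> A \<inter> B"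
  shows "\<Inter>\<C> \<noteq> {}"
proof -
  have "\<exists>C\<in>\<C>. C \<subseteq> \<Inter>\<F>" if "finite \<F>" "\<F> \<subseteq> \<C>" for \<F>
    using that
  proof (induction \<F> rule: finite_induct)
    case empty
    obtain C where "C \<in> \<C>" using assms(2) by auto
    then show ?case by auto
  next
    case (insert A \<F>)
    then have A: "A \<in> \<C>" and "\<F> \<subseteq> \<C>" by simp_all
    from insert.IH[OF this(2)] obtain C where C: "C \<in> \<C>" "C \<subseteq> \<Inter>\<F>" ..
    from assms(4)[OF A C(1)] obtain D where D: "D \<in> \<C>" "D \<subseteq> A \<inter> C" ..
    have "D \<subseteq> \<Inter>(insert A \<F>)" using C(2) D(2) by auto
    with D(1) show ?case ..
  qed
  then have "\<forall>\<F>. finite \<F> \<and> \<F> \<subseteq> \<C> \<longrightarrow> \<Inter>\<F> \<noteq> {}"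
    using assms(3) by (metis subset_empty)
  moreover have "\<forall>C\<in>\<C>. closedin T C" using assms(3) by simp
  ultimately show ?thesis
    using assms(1)[unfolded compact_space_fip, THEN spec, of \<C>] by simp
qed

text \<open>A finite form of the Baire argument: closedness allows the sets to be added one at a
  time without creating interior.\<close>

lemma interior_of_finite_Union_closed_empty:
  assumes "finite I" "\<And>i. i \<in> I \<Longrightarrow> closedin T (C i) \<and> T interior_of C i = {}"
  shows "T interior_of (\<Union>i\<in>I. C i) = {}"
  using assms by (induction I rule: finite_induct) (auto simp: interior_of_union_eq_empty)

lemma closedin_Collect_ball:
  assumes "\<And>x. x \<in> A \<Longrightarrow> closedin T {z \<in> topspace T. P x z}"
  shows "closedin T {z \<in> topspace T. \<forall>x\<in>A. P x z}"
proof -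
  \<comment> \<open>Inserting \<open>topspace T\<close> keeps the intersected family nonempty when
    \<open>A\<close> is empty.\<close>
  have "{z \<in> topspace T. \<forall>x\<in>A. P x z}
      = \<Inter>(insert (topspace T) ((\<lambda>x. {z \<in> topspace T. P x z}) ` A))"
    by auto
  then show ?thesis
    by (simp only:) (rule closedin_Inter, use assms in auto)
qed

lemma closedin_Collect_conj:
  assumes "closedin T {z \<in> topspace T. P z}" "closedin T {z \<in> topspace T. Q z}"
  shows "closedin T {z \<in> topspace T. P z \<and> Q z}"
proof -
  have "{z \<in> topspace T. P z \<and> Q z} = {z \<in> topspace T. P z} \<inter> {z \<in> topspace T. Q z}"
    by auto
  then show ?thesis using assms by auto
qed

section \<open>Compact flows and their minimal sets\<close>

text \<open>One setting for \<open>X\<close>, its square, its powers and the product of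
  \<open>X\<close> with a power, all of which call for the same facts on minimal sets. The action
  laws are stated on the phase space only, since an element of \<open>BijGroup X\<close> is
  \<open>undefined\<close> outside \<open>X\<close>.\<close>

locale compact_flow = group G
  for G :: "('g, 'm) monoid_scheme" (structure)
    and T :: "'a topology" and \<phi> :: "'g \<Rightarrow> 'a \<Rightarrow> 'a" +
  assumes compact: "compact_space T" and Hausdorff: "Hausdorff_space T"
    and cont: "g \<in> carrier G \<Longrightarrow> continuous_map T T (\<phi> g)"
    and one_act: "x \<in> topspace T \<Longrightarrow> \<phi> \<one> x = x"
    and mult_act: "\<lbrakk>g \<in> carrier G; h \<in> carrier G; x \<in> topspace T\<rbrakk>
      \<Longrightarrow> \<phi> (g \<otimes> h) x = \<phi> g (\<phi> h x)"
begin

lemma act_closed: "g \<in> carrier G \<Longrightarrow> x \<in> topspace T \<Longrightarrow> \<phi> g x \<in> topspace T"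
  using cont by (auto simp: continuous_map_def)

lemma inv_act: "g \<in> carrier G \<Longrightarrow> x \<in> topspace T \<Longrightarrow> \<phi> (inv g) (\<phi> g x) = x"
  using mult_act[of "inv g" g x] one_act by simp

lemma act_inv: "g \<in> carrier G \<Longrightarrow> x \<in> topspace T \<Longrightarrow> \<phi> g (\<phi> (inv g) x) = x"
  using mult_act[of g "inv g" x] one_act by simp

text \<open>Zorn's lemma for maximal sets is applied to the complements of subsystems; compactness
  keeps the intersection of a chain of subsystems nonempty.\<close>

lemma ex_minimal_set:
  assumes "subsystem G T \<phi> A"
  obtains B where "minimal_set G T \<phi> B" "B \<subseteq> A"
proof -
  define \<S> where "\<S> = {B. subsystem G T \<phi> B \<and> B \<subseteq> A}"
  let ?co = "\<lambda>B. topspace T - B"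
  have sub: "B \<subseteq> topspace T" if "subsystem G T \<phi> B" for B
    using that closedin_subset by (auto simp: subsystem_def)
  then have anti: "C \<subseteq> B" if "?co B \<subseteq> ?co C" "C \<in> \<S>" for B C
    using that unfolding \<S>_def by blast
  have "\<exists>M\<in>?co ` \<S>. \<forall>X\<in>?co ` \<S>. M \<subseteq> X \<longrightarrow> X = M"
  proof (rule subset_Zorn_nonempty)
    have "A \<in> \<S>" using assms by (simp add: \<S>_def)
    then show "?co ` \<S> \<noteq> {}" by auto
    fix \<C> assume \<C>: "\<C> \<noteq> {}" "subset.chain (?co ` \<S>) \<C>"
    define \<B> where "\<B> = {B \<in> \<S>. ?co B \<in> \<C>}"
    have \<C>_eq: "\<C> = ?co ` \<B>"
      using \<C>(2) unfolding subset_chain_def \<B>_def by auto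
    then have "\<B> \<noteq> {}" using \<C>(1) by auto
    have sys: "subsystem G T \<phi> B" "B \<subseteq> A" if "B \<in> \<B>" for B
      using that by (auto simp: \<B>_def \<S>_def)
    have "\<Inter>\<B> \<noteq> {}"
    proof (rule compact_space_directed_Inter[OF compact \<open>\<B> \<noteq> {}\<close>])
      show "closedin T C \<and> C \<noteq> {}" if "C \<in> \<B>" for C
        using sys(1)[OF that] by (simp add: subsystem_def)
      fix B C assume BC: "B \<in> \<B>" "C \<in> \<B>"
      then have "?co B \<subseteq> ?co C \<or> ?co C \<subseteq> ?co B"
        using \<C>(2) unfolding subset_chain_def \<B>_def by auto
      then have "C \<subseteq> B \<or> B \<subseteq> C"
        using anti BC by (auto simp: \<B>_def)
      then show "\<exists>D\<in>\<B>. D \<subseteq> B \<inter> C" using BC by auto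
    qed
    moreover have "closedin T (\<Inter>\<B>)"
      using \<open>\<B> \<noteq> {}\<close> sys(1) by (intro closedin_Inter) (auto simp: subsystem_def)
    moreover have "\<phi> g x \<in> \<Inter>\<B>" if "g \<in> carrier G" "x \<in> \<Inter>\<B>" for g x
      using that sys(1) by (auto simp: subsystem_def)
    ultimately have "subsystem G T \<phi> (\<Inter>\<B>)"
      by (simp add: subsystem_def)
    moreover have "\<Inter>\<B> \<subseteq> A"
      using \<open>\<B> \<noteq> {}\<close> sys(2) by auto
    ultimately have "\<Inter>\<B> \<in> \<S>" by (simp add: \<S>_def)
    moreover have "\<Union>\<C> = ?co (\<Inter>\<B>)"
      using \<open>\<B> \<noteq> {}\<close> by (auto simp: \<C>_eq)
    ultimately show "\<Union>\<C> \<in> ?co ` \<S>" by simp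
  qed
  then obtain B where B: "B \<in> \<S>"
    and max: "\<And>C. C \<in> \<S> \<Longrightarrow> ?co B \<subseteq> ?co C \<Longrightarrow> ?co C = ?co B"
    by auto
  have "C = B" if "subsystem G T \<phi> C" "C \<subseteq> B" for C
  proof -
    have C: "C \<in> \<S>" using that B by (auto simp: \<S>_def)
    then have "?co C = ?co B" using that(2) by (intro max) auto
    then have "B \<subseteq> C" by (intro anti[OF _ B]) simp
    then show ?thesis using that(2) by simp
  qed
  then have "minimal_set G T \<phi> B" using B by (simp add: minimal_set_def \<S>_def)
  then show thesis using B that by (auto simp: \<S>_def)
qed

text \<open>Inverses make the complement of an invariant set invariant, so \<open>B - W\<close>, if
  nonempty, would be a proper subsystem of \<open>B\<close>.\<close>

lemma minimal_set_subset_open: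
  assumes B: "minimal_set G T \<phi> B" and W: "openin T W" "B \<inter> W \<noteq> {}"
    and inv: "\<And>g x. g \<in> carrier G \<Longrightarrow> x \<in> W \<Longrightarrow> \<phi> g x \<in> W"
  shows "B \<subseteq> W"
proof (rule ccontr)
  assume "\<not> B \<subseteq> W"
  have B': "closedin T B" "\<And>g x. g \<in> carrier G \<Longrightarrow> x \<in> B \<Longrightarrow> \<phi> g x \<in> B"
    using B by (auto simp: minimal_set_def subsystem_def)
  have "\<phi> g x \<in> B - W" if "g \<in> carrier G" "x \<in> B - W" for g x
  proof -
    have "x \<in> topspace T" using that B'(1) closedin_subset by auto
    then show ?thesis
      using inv[of "inv g" "\<phi> g x"] that B'(2) inv_act by auto
  qed
  then have "subsystem G T \<phi> (B - W)"
    using B'(1) W(1) \<open>\<not> B \<subseteq> W\<close> by (auto simp: subsystem_def)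
  then have "B - W = B" using B by (simp add: minimal_set_def)
  then show False using W(2) by blast
qed

text \<open>The points that some group element sends into \<open>W\<close> form an open invariant
  set meeting \<open>B\<close>, hence containing it, and compactness leaves finitely many elements.
  This is syndetic return to \<open>W\<close>.\<close>

lemma minimal_set_finite_cover:
  assumes B: "minimal_set G T \<phi> B" and W: "openin T W" "B \<inter> W \<noteq> {}"
  obtains F where "finite F" "F \<subseteq> carrier G" "\<forall>x\<in>B. \<exists>g\<in>F. \<phi> g x \<in> W"
proof -
  let ?P = "\<lambda>g. {x \<in> topspace T. \<phi> g x \<in> W}"
  have op: "openin T (?P g)" if "g \<in> carrier G" for g
    using openin_continuous_map_preimage[OF cont W(1)] that by blast
  have "B \<subseteq> (\<Union>g\<in>carrier G. ?P g)"
  proof (rule minimal_set_subset_open[OF B])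
    show "openin T (\<Union>g\<in>carrier G. ?P g)" using op by blast
    show "B \<inter> (\<Union>g\<in>carrier G. ?P g) \<noteq> {}"
      using W openin_subset[OF W(1)] one_act one_closed by fastforce
    fix g x assume g: "g \<in> carrier G" and "x \<in> (\<Union>g\<in>carrier G. ?P g)"
    then obtain h where h: "h \<in> carrier G" "x \<in> topspace T" "\<phi> h x \<in> W" by blast
    then have "\<phi> (h \<otimes> inv g) (\<phi> g x) \<in> W"
      using g by (simp add: mult_act inv_act act_closed)
    then show "\<phi> g x \<in> (\<Union>g\<in>carrier G. ?P g)"
      using g h act_closed by blast
  qed
  moreover have "compactin T B"
    using B compact by (simp add: closedin_compact_space minimal_set_def subsystem_def)
  ultimately obtain \<F> where "finite \<F>" "\<F> \<subseteq> ?P ` carrier G" "B \<subseteq> \<Union>\<F>"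
    using op compactinD[of T B "?P ` carrier G"] by auto
  then obtain F where F: "finite F" "F \<subseteq> carrier G" "\<F> = ?P ` F"
    using finite_subset_image by meson
  have "\<exists>g\<in>F. \<phi> g x \<in> W" if "x \<in> B" for x
    using that \<open>B \<subseteq> \<Union>\<F>\<close> F(3) by auto
  then show thesis using that F(1,2) by blast
qed

text \<open>Closed sets are compact here, so their images in a Hausdorff space are closed;
  equivariance transports invariance.\<close>

lemma subsystem_image:
  assumes S: "compact_flow G S \<psi>" and A: "subsystem G T \<phi> A"
    and p: "continuous_map T S p"
    and eq: "\<And>g x. g \<in> carrier G \<Longrightarrow> x \<in> topspace T \<Longrightarrow> p (\<phi> g x) = \<psi> g (p x)"
  shows "subsystem G S \<psi> (p ` A)"
proof -
  interpret S: compact_flow G S \<psi> by (rule S)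
  have A': "A \<noteq> {}" "closedin T A" "A \<subseteq> topspace T"
    "\<And>g x. g \<in> carrier G \<Longrightarrow> x \<in> A \<Longrightarrow> \<phi> g x \<in> A"
    using A closedin_subset by (auto simp: subsystem_def)
  have "closedin S (p ` A)"
    by (meson A'(2) S.Hausdorff closedin_compact_space compact compactin_imp_closedin
        image_compactin p)
  moreover have "\<psi> g (p x) \<in> p ` A" if "g \<in> carrier G" "x \<in> A" for g x
    using eq[of g x] A' that by (metis image_eqI subsetD)
  ultimately show ?thesis using A'(1) by (auto simp: subsystem_def)
qed

text \<open>Finitely many translates of a closed neighbourhood inside \<open>W\<close> cover \<open>B\<close>, hence
  their images cover \<open>S\<close>, and not all of these closed sets can have empty interior.\<close>

lemma minimal_set_image_interior:
  assumes S: "compact_flow G S \<psi>" "minimal_system G S \<psi>" "topspace S \<noteq> {}"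
    and B: "minimal_set G T \<phi> B" and W: "openin T W" "B \<inter> W \<noteq> {}"
    and p: "continuous_map T S p"
    and eq: "\<And>g x. g \<in> carrier G \<Longrightarrow> x \<in> topspace T \<Longrightarrow> p (\<phi> g x) = \<psi> g (p x)"
  obtains A where "openin S A" "A \<noteq> {}" "A \<subseteq> p ` (B \<inter> W)"
proof -
  interpret S: compact_flow G S \<psi> by (rule S)
  have B': "closedin T B" "B \<subseteq> topspace T"
    "\<And>g x. g \<in> carrier G \<Longrightarrow> x \<in> B \<Longrightarrow> \<phi> g x \<in> B"
    using B closedin_subset by (auto simp: minimal_set_def subsystem_def)
  \<comment> \<open>The image of \<open>B\<close> is a subsystem of a minimal system, hence
    everything.\<close>
  have pB: "p ` B = topspace S"
    using minimal_system_subsystem_eq[OF S(2) subsystem_image[OF S(1) _ p eq]] B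
    by (simp add: minimal_set_def)
  obtain b where b: "b \<in> B" "b \<in> W" using W by blast
  \<comment> \<open>A closed neighbourhood \<open>C\<close> inside \<open>W\<close> makes the image
    \<open>E\<close> of \<open>B \<inter> C\<close> closed, as the finite union argument
    demands.\<close>
  have "neighbourhood_base_of (closedin T) T"
    by (simp add: compact Hausdorff compact_Hausdorff_imp_regular_space
        neighbourhood_base_of_closedin)
  then obtain V C where V: "openin T V" "closedin T C" "b \<in> V" "V \<subseteq> C" "C \<subseteq> W"
    using W(1) b(2) unfolding neighbourhood_base_of by meson
  obtain F where F: "finite F" "F \<subseteq> carrier G" "\<forall>x\<in>B. \<exists>g\<in>F. \<phi> g x \<in> V"
    using minimal_set_finite_cover[OF B V(1)] b(1) V(3) by blast
  define E where "E = p ` (B \<inter> C)"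
  have E: "closedin S E"
    unfolding E_def
    by (meson B'(1) V(2) S.Hausdorff closedin_Int closedin_compact_space compact
        compactin_imp_closedin image_compactin p)
  let ?E = "\<lambda>g. {y \<in> topspace S. \<psi> g y \<in> E}"
  have cover: "topspace S = (\<Union>g\<in>F. ?E g)"
  proof
    show "topspace S \<subseteq> (\<Union>g\<in>F. ?E g)"
    proof
      fix y assume y: "y \<in> topspace S"
      then obtain x where x: "x \<in> B" "y = p x" using pB by auto
      then obtain g where g: "g \<in> F" "\<phi> g x \<in> V" using F(3) by blast
      have "\<psi> g y = p (\<phi> g x)" using eq[of g x] g F(2) x B'(2) by (auto simp: subset_iff)
      moreover have "\<phi> g x \<in> B \<inter> C" using B'(3) g F(2) V(4) x(1) by blast
      ultimately show "y \<in> (\<Union>g\<in>F. ?E g)" using y g(1) by (auto simp: E_def)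
    qed
  qed auto
  have "S interior_of E \<noteq> {}"
  proof
    assume int: "S interior_of E = {}"
    have "closedin S (?E g) \<and> S interior_of ?E g = {}" if "g \<in> F" for g
    proof
      have g: "g \<in> carrier G" using that F(2) by auto
      show "closedin S (?E g)"
        using closedin_continuous_map_preimage[OF S.cont[OF g] E] .
      \<comment> \<open>This is the translate by \<open>g\<close> of the interior of
        \<open>?E g\<close>: an open subset of \<open>E\<close>, hence empty.\<close>
      let ?A = "{z \<in> topspace S. \<psi> (inv g) z \<in> S interior_of ?E g}"
      have "openin S ?A"
        using openin_continuous_map_preimage[OF S.cont openin_interior_of] g by simp
      moreover have "?A \<subseteq> E"
        using S.act_inv[OF g] interior_of_subset[of S "?E g"] by force
      ultimately have A: "?A = {}" using int interior_of_maximal by fastforce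
      show "S interior_of ?E g = {}"
      proof (rule ccontr)
        assume "S interior_of ?E g \<noteq> {}"
        then obtain y where y: "y \<in> S interior_of ?E g" by blast
        then have "y \<in> topspace S" using interior_of_subset_topspace[of S "?E g"] by auto
        then have "\<psi> g y \<in> ?A" using y S.inv_act[OF g] S.act_closed[OF g] by simp
        then show False using A by blast
      qed
    qed
    then have "S interior_of topspace S = {}"
      using interior_of_finite_Union_closed_empty[OF F(1), of S ?E] cover by simp
    then show False using S(3) by (simp add: interior_of_topspace)
  qed
  moreover have "E \<subseteq> p ` (B \<inter> W)" using V(5) by (auto simp: E_def)
  ultimately show thesis
    using that[OF openin_interior_of] interior_of_subset[of S E] by blast
qed

end

section \<open>Products and powers of compact flows\<close>

lemma compact_flow_prod:
  assumes "compact_flow G T \<phi>" "compact_flow G S \<psi>"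
  shows "compact_flow G (prod_topology T S) (\<lambda>g p. (\<phi> g (fst p), \<psi> g (snd p)))"
proof -
  interpret T: compact_flow G T \<phi> by (rule assms)
  interpret S: compact_flow G S \<psi> by (rule assms)
  show ?thesis
  proof
    show "compact_space (prod_topology T S)"
      by (simp add: T.compact S.compact compact_space_prod_topology)
    show "Hausdorff_space (prod_topology T S)"
      by (simp add: T.Hausdorff S.Hausdorff Hausdorff_space_prod_topology)
    show "continuous_map (prod_topology T S) (prod_topology T S)
        (\<lambda>p. (\<phi> g (fst p), \<psi> g (snd p)))" if "g \<in> carrier G" for g
      using continuous_map_compose[OF continuous_map_fst T.cont[OF that], of S]
        continuous_map_compose[OF continuous_map_snd S.cont[OF that], of T]
      by (simp add: continuous_map_paired o_def)
  qed (auto simp: T.one_act S.one_act T.mult_act S.mult_act)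
qed

lemma compact_flow_pair:
  "compact_flow G T \<phi> \<Longrightarrow> compact_flow G (prod_topology T T) (pair_action \<phi>)"
  using compact_flow_prod[of G T \<phi> T \<phi>] by (simp add: pair_action_def[abs_def])

lemma compact_flow_power:
  assumes "compact_flow G T \<phi>"
  shows "compact_flow G (power_topology n T) (power_action n \<phi>)"
proof -
  interpret T: compact_flow G T \<phi> by (rule assms)
  show ?thesis
    unfolding power_topology_def
  proof
    let ?P = "product_topology (\<lambda>_. T) {1..n}"
    show "compact_space ?P"
      by (simp add: T.compact compact_space_product_topology)
    show "Hausdorff_space ?P"
      by (simp add: T.Hausdorff Hausdorff_space_product_topology)
    show "continuous_map ?P ?P (power_action n \<phi> g)" if "g \<in> carrier G" for g
      unfolding continuous_map_componentwise
    proof (intro conjI ballI)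
      fix i assume i: "i \<in> {1..n}"
      have "continuous_map ?P T (\<lambda>x. \<phi> g (x i))"
        using continuous_map_compose[OF continuous_map_product_projection[OF i] T.cont[OF that]]
        by (simp add: o_def)
      then show "continuous_map ?P T (\<lambda>x. power_action n \<phi> g x i)"
        using i by (simp add: power_action_def)
    qed (auto simp: power_action_def)
    show "power_action n \<phi> \<one>\<^bsub>G\<^esub> x = x" if "x \<in> topspace ?P" for x
    proof -
      have x: "x i \<in> topspace T" if "i \<in> {1..n}" for i
        using \<open>x \<in> topspace ?P\<close> that unfolding topspace_product_topology by (rule PiE_mem)
      have "power_action n \<phi> \<one>\<^bsub>G\<^esub> x = restrict x {1..n}"
        unfolding power_action_def by (intro restrict_ext) (rule T.one_act[OF x])
      then show ?thesis
        using that unfolding topspace_product_topology by (simp add: PiE_restrict)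
    qed
    show "power_action n \<phi> (g \<otimes>\<^bsub>G\<^esub> h) x = power_action n \<phi> g (power_action n \<phi> h x)"
      if "g \<in> carrier G" "h \<in> carrier G" "x \<in> topspace ?P" for g h x
    proof -
      have x: "x i \<in> topspace T" if "i \<in> {1..n}" for i
        using \<open>x \<in> topspace ?P\<close> that unfolding topspace_product_topology by (rule PiE_mem)
      show ?thesis
        unfolding power_action_def
        using T.mult_act[OF that(1,2) x] by (intro restrict_ext) simp
    qed
  qed
qed

section \<open>Regional proximality\<close>

sublocale topological_dynamical_system \<subseteq> flow: compact_flow G mtopology \<phi>
proof -
  interpret group_hom G "BijGroup X" \<phi> by (rule group_hom)
  show "compact_flow G mtopology \<phi>"
  proof
    show "compact_space mtopology" by (rule compact)
    show "Hausdorff_space mtopology" by (rule Hausdorff_space_mtopology)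
    show "continuous_map mtopology mtopology (\<phi> g)" if "g \<in> carrier G" for g
      using that by (rule continuous_action)
    show "\<phi> \<one> x = x" if "x \<in> topspace mtopology" for x
      using that fun_cong[OF id_eq_one, of x] by simp
    show "\<phi> (g \<otimes> h) x = \<phi> g (\<phi> h x)"
      if "g \<in> carrier G" "h \<in> carrier G" "x \<in> topspace mtopology" for g h x
      using that composition_rule by simp
  qed
qed

context topological_dynamical_system
begin

abbreviation "pair_topology \<equiv> prod_topology mtopology mtopology"

lemma act_in: "g \<in> carrier G \<Longrightarrow> x \<in> X \<Longrightarrow> \<phi> g x \<in> X"
  using flow.act_closed by simp

lemma continuous_map_dist:
  assumes "continuous_map S mtopology f" "continuous_map S mtopology g"
  shows "continuous_map S euclideanreal (\<lambda>x. d (f x) (g x))"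
  using continuous_map_mdist[of S Self f g] assms by (simp add: mtopology_of_def)

lemma continuous_map_act_dist:
  assumes "g \<in> carrier G"
  shows "continuous_map pair_topology euclideanreal (\<lambda>p. d (\<phi> g (fst p)) (\<phi> g (snd p)))"
  using continuous_map_compose[OF continuous_map_fst flow.cont[OF assms]]
    continuous_map_compose[OF continuous_map_snd flow.cont[OF assms]]
  by (intro continuous_map_dist) (simp_all only: o_def)

lemma uniformly_continuous_act:
  assumes "finite F" "F \<subseteq> carrier G" "0 < \<epsilon>"
  obtains \<delta> where "0 < \<delta>"
    "\<forall>g\<in>F. \<forall>x\<in>X. \<forall>y\<in>X. d x y < \<delta> \<longrightarrow> d (\<phi> g x) (\<phi> g y) < \<epsilon>"
proof -
  have "\<exists>\<delta>>0. \<forall>x\<in>X. \<forall>y\<in>X. d x y < \<delta> \<longrightarrow> d (\<phi> g x) (\<phi> g y) < \<epsilon>" if "g \<in> F" for g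
  proof -
    have "uniformly_continuous_map Self Self (\<phi> g)"
      using that assms(2) compact continuous_action
      by (intro continuous_imp_uniformly_continuous_map) (auto simp: mtopology_of_def)
    then show ?thesis
      using assms(3) unfolding uniformly_continuous_map_def mspace_Self mdist_Self by blast
  qed
  then obtain \<delta> where \<delta>: "\<And>g. g \<in> F \<Longrightarrow> 0 < \<delta> g"
    "\<And>g x y. g \<in> F \<Longrightarrow> x \<in> X \<Longrightarrow> y \<in> X \<Longrightarrow> d x y < \<delta> g \<Longrightarrow> d (\<phi> g x) (\<phi> g y) < \<epsilon>"
    by metis
  show thesis
  proof (rule that)
    \<comment> \<open>The extra \<open>1\<close> keeps the minimum meaningful for empty
      \<open>F\<close>.\<close>
    show "0 < Min (insert 1 (\<delta> ` F))" using assms(1) \<delta>(1) by simp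
    show "\<forall>g\<in>F. \<forall>x\<in>X. \<forall>y\<in>X. d x y < Min (insert 1 (\<delta> ` F))
        \<longrightarrow> d (\<phi> g x) (\<phi> g y) < \<epsilon>"
      using assms(1) by (intro ballI impI \<delta>(2)) auto
  qed
qed

text \<open>These are open invariant approximations of the regionally proximal relation, which is
  the intersection of their closures.\<close>

definition near_pairs :: "real \<Rightarrow> ('a \<times> 'a) set" where
  "near_pairs \<epsilon> = {p \<in> X \<times> X. \<exists>g\<in>carrier G. d (\<phi> g (fst p)) (\<phi> g (snd p)) < \<epsilon>}"

lemma near_pairs_mono: "\<epsilon> \<le> \<epsilon>' \<Longrightarrow> near_pairs \<epsilon> \<subseteq> near_pairs \<epsilon>'"
  unfolding near_pairs_def by (auto intro: order_less_le_trans)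

lemma openin_dist_act:
  assumes "g \<in> carrier G"
  shows "openin pair_topology {p \<in> X \<times> X. d (\<phi> g (fst p)) (\<phi> g (snd p)) < \<epsilon>}"
proof -
  have "openin pair_topology
      {p \<in> topspace pair_topology. d (\<phi> g (fst p)) (\<phi> g (snd p)) \<in> {..<\<epsilon>}}"
    by (intro openin_continuous_map_preimage[OF continuous_map_act_dist[OF assms]]) simp
  then show ?thesis by (simp only: topspace_prod_topology topspace_mtopology lessThan_iff)
qed

lemma openin_near_pairs: "openin pair_topology (near_pairs \<epsilon>)"
proof -
  have "near_pairs \<epsilon> =
      (\<Union>g\<in>carrier G. {p \<in> X \<times> X. d (\<phi> g (fst p)) (\<phi> g (snd p)) < \<epsilon>})"
    by (auto simp: near_pairs_def)
  then show ?thesis using openin_dist_act by auto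
qed

text \<open>If \<open>g\<close> brings the pair close together, then
  \<open>g \<otimes> inv h\<close> does so for its translate by \<open>h\<close>.\<close>

lemma near_pairs_invariant:
  assumes "h \<in> carrier G" "p \<in> near_pairs \<epsilon>"
  shows "pair_action \<phi> h p \<in> near_pairs \<epsilon>"
proof -
  obtain g where p: "fst p \<in> X" "snd p \<in> X"
    and g: "g \<in> carrier G" "d (\<phi> g (fst p)) (\<phi> g (snd p)) < \<epsilon>"
    using assms(2) by (auto simp: near_pairs_def)
  have "\<phi> (g \<otimes> inv h) (\<phi> h x) = \<phi> g x" if "x \<in> X" for x
    using that g(1) assms(1) act_in
    by (simp add: flow.mult_act flow.inv_act)
  then have "d (\<phi> (g \<otimes> inv h) (\<phi> h (fst p))) (\<phi> (g \<otimes> inv h) (\<phi> h (snd p))) < \<epsilon>"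
    using p g(2) by simp
  moreover have "g \<otimes> inv h \<in> carrier G" using g(1) assms(1) by simp
  ultimately show ?thesis
    using p assms(1) act_in unfolding near_pairs_def pair_action_def by auto
qed

text \<open>The definition uses one \<epsilon> for the perturbation and for the final distance;
  taking a minimum separates the two roles. In closure form, closedness is immediate and invariance
  reduces to that of \<open>near_pairs\<close>.\<close>

lemma regionally_proximal_eq:
  "regionally_proximal G X d \<phi> = (\<Inter>\<epsilon>\<in>{0<..}. pair_topology closure_of near_pairs \<epsilon>)"
proof (intro Set.set_eqI iffI)
  fix p assume p: "p \<in> regionally_proximal G X d \<phi>"
  then have pX: "p \<in> X \<times> X" by (auto simp: regionally_proximal_def)
  show "p \<in> (\<Inter>\<epsilon>\<in>{0<..}. pair_topology closure_of near_pairs \<epsilon>)"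
  proof
    fix \<epsilon> :: real assume "\<epsilon> \<in> {0<..}"
    then have \<epsilon>: "0 < \<epsilon>" by simp
    show "p \<in> pair_topology closure_of near_pairs \<epsilon>"
      unfolding in_closure_of
    proof (intro conjI allI impI)
      show "p \<in> topspace pair_topology" using pX by simp
      fix W assume "p \<in> W \<and> openin pair_topology W"
      then obtain U V where UV: "openin mtopology U" "openin mtopology V"
        "fst p \<in> U" "snd p \<in> V" "U \<times> V \<subseteq> W"
        unfolding openin_prod_topology_alt by (metis prod.collapse)
      obtain r s where r: "r > 0" "mball (fst p) r \<subseteq> U" and s: "s > 0" "mball (snd p) s \<subseteq> V"
        using UV unfolding openin_mtopology by meson
      define e where "e = min \<epsilon> (min r s)"
      have "e > 0" using r(1) s(1) \<epsilon> by (simp add: e_def)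
      then obtain y1 y2 g where y: "y1 \<in> X" "y2 \<in> X" "d (fst p) y1 < e" "d (snd p) y2 < e"
        "g \<in> carrier G" "d (\<phi> g y1) (\<phi> g y2) < e"
        using p unfolding regionally_proximal_def by force
      have "(y1, y2) \<in> near_pairs \<epsilon>"
        using y by (auto simp: near_pairs_def e_def)
      moreover have "y1 \<in> U" "y2 \<in> V"
        using y r(2) s(2) pX by (auto simp: e_def mball_def)
      ultimately show "\<exists>y. y \<in> near_pairs \<epsilon> \<and> y \<in> W" using UV(5) by blast
    qed
  qed
next
  fix p assume p: "p \<in> (\<Inter>\<epsilon>\<in>{0<..}. pair_topology closure_of near_pairs \<epsilon>)"
  then have cl: "p \<in> pair_topology closure_of near_pairs \<epsilon>" if "\<epsilon> > 0" for \<epsilon>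
    using that by blast
  then have "p \<in> topspace pair_topology"
    using closure_of_subset_topspace[of pair_topology "near_pairs 1"] zero_less_one by blast
  then have pX: "fst p \<in> X" "snd p \<in> X" by auto
  have "\<exists>y1\<in>X. \<exists>y2\<in>X. d (fst p) y1 < \<epsilon> \<and> d (snd p) y2 < \<epsilon> \<and>
      (\<exists>g\<in>carrier G. d (\<phi> g y1) (\<phi> g y2) < \<epsilon>)" if \<epsilon>: "\<epsilon> > 0" for \<epsilon>
  proof -
    have "openin pair_topology (mball (fst p) \<epsilon> \<times> mball (snd p) \<epsilon>)"
      by (simp add: openin_prod_Times_iff)
    moreover have "p \<in> mball (fst p) \<epsilon> \<times> mball (snd p) \<epsilon>"
      using pX \<epsilon> by (cases p) simp
    ultimately have "\<exists>q. q \<in> near_pairs \<epsilon> \<and> q \<in> mball (fst p) \<epsilon> \<times> mball (snd p) \<epsilon>"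
      by (intro cl[OF \<epsilon>, unfolded in_closure_of, THEN conjunct2, rule_format] conjI)
    then obtain y1 y2 where "(y1, y2) \<in> near_pairs \<epsilon>" "y1 \<in> mball (fst p) \<epsilon>"
      "y2 \<in> mball (snd p) \<epsilon>" by auto
    then show ?thesis
      by (intro bexI[of _ y1] bexI[of _ y2]) (auto simp: near_pairs_def)
  qed
  then show "p \<in> regionally_proximal G X d \<phi>"
    using pX by (cases p) (simp add: regionally_proximal_def)
qed

lemma closedin_regionally_proximal: "closedin pair_topology (regionally_proximal G X d \<phi>)"
  unfolding regionally_proximal_eq by (intro closedin_Inter) auto

lemma regionally_proximal_invariant:
  assumes g: "g \<in> carrier G" and p: "p \<in> regionally_proximal G X d \<phi>"
  shows "pair_action \<phi> g p \<in> regionally_proximal G X d \<phi>"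
proof -
  have cont: "continuous_map pair_topology pair_topology (pair_action \<phi> g)"
    using compact_flow.cont[OF compact_flow_pair[OF flow.compact_flow_axioms] g] .
  have "pair_action \<phi> g p \<in> pair_topology closure_of near_pairs \<epsilon>" if "\<epsilon> > 0" for \<epsilon>
  proof -
    have "pair_action \<phi> g ` near_pairs \<epsilon> \<subseteq> near_pairs \<epsilon>"
      using near_pairs_invariant[OF g] by blast
    then have "pair_topology closure_of (pair_action \<phi> g ` near_pairs \<epsilon>)
        \<subseteq> pair_topology closure_of near_pairs \<epsilon>"
      by (rule closure_of_mono)
    moreover have "p \<in> pair_topology closure_of near_pairs \<epsilon>"
      using p that by (simp add: regionally_proximal_eq)
    ultimately show ?thesis
      using continuous_map_image_closure_subset[OF cont, of "near_pairs \<epsilon>"] by blast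
  qed
  then show ?thesis by (simp add: regionally_proximal_eq)
qed

section \<open>Tuples and their separation on minimal sets\<close>

lemma continuous_map_coordinate:
  "i \<in> {1..n} \<Longrightarrow> continuous_map (power_topology n mtopology) mtopology (\<lambda>z. z i)"
  unfolding power_topology_def by (rule continuous_map_product_projection)

lemma topspace_power: "topspace (power_topology n mtopology) = {1..n} \<rightarrow>\<^sub>E X"
  by (simp add: power_topology_def)

text \<open>The tuples of \<open>M\<close> whose coordinates \<open>i\<close> and \<open>j\<close>
  coincide form a closed invariant set. If nonempty it would be all of \<open>M\<close>, against the
  injectivity of \<open>xs\<close>. So each distance is positive on the compact set \<open>M\<close>
  and attains a positive minimum.\<close>

lemma minimal_set_separated:
  assumes M: "minimal_set G (power_topology n mtopology) (power_action n \<phi>) M"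
    and xs: "xs \<in> M" "inj_on xs {1..n}"
  obtains \<delta> where "\<delta> > 0"
    "\<And>z i j. z \<in> M \<Longrightarrow> i \<in> {1..n} \<Longrightarrow> j \<in> {1..n} \<Longrightarrow> i < j \<Longrightarrow> \<delta> \<le> d (z i) (z j)"
proof -
  interpret P: compact_flow G "power_topology n mtopology" "power_action n \<phi>"
    by (rule compact_flow_power) (rule flow.compact_flow_axioms)
  have M': "closedin (power_topology n mtopology) M" "M \<subseteq> {1..n} \<rightarrow>\<^sub>E X"
    "\<And>g z. g \<in> carrier G \<Longrightarrow> z \<in> M \<Longrightarrow> power_action n \<phi> g z \<in> M"
    using M closedin_subset[of _ M] unfolding minimal_set_def subsystem_def topspace_power[symmetric]
    by blast+
  have zX: "z i \<in> X" if "z \<in> M" "i \<in> {1..n}" for z i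
    using M'(2) that by (meson PiE_mem subsetD)
  have "\<exists>\<delta>>0. \<forall>z\<in>M. \<delta> \<le> d (z i) (z j)"
    if ij: "i \<in> {1..n}" "j \<in> {1..n}" "i < j" for i j
  proof -
    let ?f = "\<lambda>z. d (z i) (z j)"
    have f: "continuous_map (power_topology n mtopology) euclideanreal ?f"
      using ij by (intro continuous_map_dist continuous_map_coordinate)
    let ?E = "{z \<in> M. ?f z \<in> {0}}"
    have "z i \<noteq> z j" if "z \<in> M" for z
    proof
      assume "z i = z j"
      then have "z \<in> ?E" using that zX ij by simp
      moreover have "closedin (power_topology n mtopology) ?E"
        by (rule closedin_continuous_map_preimage_gen[OF f M'(1)]) simp
      moreover have "power_action n \<phi> g z \<in> ?E" if "g \<in> carrier G" "z \<in> ?E" for g z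
        using that M'(3) zX ij act_in by (auto simp: power_action_def)
      ultimately have "subsystem G (power_topology n mtopology) (power_action n \<phi>) ?E"
        unfolding subsystem_def by blast
      then have "?E = M" using M unfolding minimal_set_def by blast
      then have "d (xs i) (xs j) = 0" using xs(1) by blast
      then have "xs i = xs j" using zX[OF xs(1)] ij by simp
      then show False using inj_onD[OF xs(2) _ ij(1,2)] ij(3) by simp
    qed
    then have pos: "?f z > 0" if "z \<in> M" for z
      using that zX ij by (simp add: mdist_pos_less)
    have "compactin (power_topology n mtopology) M"
      using M'(1) P.compact by (simp add: closedin_compact_space)
    then have "compact (?f ` M)"
      using image_compactin[OF _ f] by (simp flip: compactin_euclidean_iff)
    then obtain z where "z \<in> M" "\<And>y. y \<in> M \<Longrightarrow> ?f z \<le> ?f y"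
      using compact_attains_inf[of "?f ` M"] xs(1) by auto
    then show ?thesis using pos by blast
  qed
  then obtain \<delta> where \<delta>: "\<And>i j. i \<in> {1..n} \<Longrightarrow> j \<in> {1..n} \<Longrightarrow> i < j \<Longrightarrow> 0 < \<delta> i j"
    "\<And>i j z. i \<in> {1..n} \<Longrightarrow> j \<in> {1..n} \<Longrightarrow> i < j \<Longrightarrow> z \<in> M \<Longrightarrow> \<delta> i j \<le> d (z i) (z j)"
    by metis
  let ?I = "{p \<in> {1..n} \<times> {1..n}. fst p < snd p}"
  \<comment> \<open>The \<open>1\<close> covers the case that there is no pair
    \<open>i < j\<close>.\<close>
  let ?D = "insert 1 (case_prod \<delta> ` ?I)"
  have fin: "finite ?D" by simp
  show thesis
  proof (rule that)
    show "Min ?D > 0" using fin \<delta>(1) by (subst Min_gr_iff) auto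
    show "Min ?D \<le> d (z i) (z j)" if "z \<in> M" "i \<in> {1..n}" "j \<in> {1..n}" "i < j" for z i j
    proof -
      have "\<delta> i j \<in> ?D" using that by force
      then have "Min ?D \<le> \<delta> i j" using fin by (rule Min_le[rotated])
      also have "\<dots> \<le> d (z i) (z j)" using that by (intro \<delta>(2))
      finally show ?thesis .
    qed
  qed
qed

section \<open>From sensitivity to minimal tuples\<close>

text \<open>The parameters \<open>F\<close> and \<open>R\<close> allow one definition for the finite
  stages and for their limit, where \<open>F\<close> is the whole group and \<open>R\<close> the
  regionally proximal relation. Letting \<open>j\<close> range over \<open>{i<..n}\<close> turns
  \<open>i < j\<close> into a bounded quantifier, so that closedness follows condition by
  condition.\<close>

definition separated_tuples :: "nat \<Rightarrow> real \<Rightarrow> 'g set \<Rightarrow> ('a \<times> 'a) set \<Rightarrow> (nat \<Rightarrow> 'a) set" where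
  "separated_tuples n \<delta> F R = {z \<in> topspace (power_topology n mtopology).
     (\<forall>g\<in>F. \<forall>i\<in>{1..n}. \<forall>j\<in>{i<..n}. \<delta> \<le> d (\<phi> g (z i)) (\<phi> g (z j))) \<and>
     (\<forall>i\<in>{1..n}. \<forall>j\<in>{1..n}. (z i, z j) \<in> R)}"

lemma closedin_separated_tuples:
  assumes F: "F \<subseteq> carrier G" and R: "closedin pair_topology R"
  shows "closedin (power_topology n mtopology) (separated_tuples n \<delta> F R)"
  unfolding separated_tuples_def
proof (intro closedin_Collect_conj closedin_Collect_ball)
  fix g i j assume g: "g \<in> F" and ij: "i \<in> {1..n}" "j \<in> {i<..n}"
  have g': "continuous_map mtopology mtopology (\<phi> g)"
    using g F continuous_action by auto
  have "continuous_map (power_topology n mtopology) mtopology (\<lambda>z. \<phi> g (z k))"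
    if "k \<in> {1..n}" for k
    using continuous_map_compose[OF continuous_map_coordinate[OF that] g'] by (simp add: o_def)
  then have "continuous_map (power_topology n mtopology) euclideanreal
      (\<lambda>z. d (\<phi> g (z i)) (\<phi> g (z j)))"
    using ij by (intro continuous_map_dist) auto
  from closedin_continuous_map_preimage[OF this, of "{\<delta>..}"]
  show "closedin (power_topology n mtopology) {z \<in> topspace (power_topology n mtopology).
      \<delta> \<le> d (\<phi> g (z i)) (\<phi> g (z j))}"
    by simp
next
  fix i j assume ij: "i \<in> {1..n}" "j \<in> {1..n}"
  have "continuous_map (power_topology n mtopology) pair_topology (\<lambda>z. (z i, z j))"
    using ij by (simp add: continuous_map_paired continuous_map_coordinate)
  from closedin_continuous_map_preimage[OF this R]
  show "closedin (power_topology n mtopology) {z \<in> topspace (power_topology n mtopology).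
      (z i, z j) \<in> R}" .
qed

text \<open>Sensitivity makes every finite stage nonempty, and compactness gives a tuple common to
  all stages. The tuples in the limit form a subsystem of the power, and any point \<open>y\<close>
  of a minimal set inside it will do, with base point \<open>y 1\<close>.\<close>

lemma sensitive_imp_minimal_tuple:
  assumes "blockily_thickly_sensitive n G X d \<phi>" and n: "n \<ge> 2"
  shows "\<exists>x\<in>X. \<exists>xs \<in> {1..n} \<rightarrow>\<^sub>E (regionally_proximal G X d \<phi> `` {x}).
    inj_on xs {1..n} \<and> minimal_point G (power_topology n mtopology) (power_action n \<phi>) xs"
proof -
  interpret P: compact_flow G "power_topology n mtopology" "power_action n \<phi>"
    by (rule compact_flow_power) (rule flow.compact_flow_axioms)
  obtain \<delta> where \<delta>: "\<delta> > 0" and sens: "\<And>F U. \<lbrakk>finite F; F \<subseteq> carrier G; openin mtopology U; U \<noteq> {}\<rbrakk>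
      \<Longrightarrow> \<exists>xs \<in> {1..n} \<rightarrow>\<^sub>E U. \<exists>h\<in>carrier G. \<forall>g\<in>F. \<forall>i\<in>{1..n}. \<forall>j\<in>{1..n}.
           i < j \<longrightarrow> d (\<phi> (g \<otimes> h) (xs i)) (\<phi> (g \<otimes> h) (xs j)) > \<delta>"
    using assms(1) unfolding blockily_thickly_sensitive_def by metis
  define K where "K = (\<lambda>(F, \<epsilon>). separated_tuples n \<delta> F (pair_topology closure_of near_pairs \<epsilon>))"
  define I where "I = {F. finite F \<and> F \<subseteq> carrier G} \<times> {0::real<..}"
  have K_ne: "K (F, \<epsilon>) \<noteq> {}" if F: "finite F" "F \<subseteq> carrier G" and \<epsilon>: "\<epsilon> > 0" for F \<epsilon>
  proof -
    obtain x where x: "x \<in> X" using nonempty by auto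
    then have "mball x (\<epsilon>/2) \<noteq> {}" using \<epsilon> by (metis centre_in_mball_iff empty_iff half_gt_zero)
    then obtain xs h where xs: "xs \<in> {1..n} \<rightarrow>\<^sub>E mball x (\<epsilon>/2)" and h: "h \<in> carrier G"
      and sep: "\<And>g i j. \<lbrakk>g \<in> F; i \<in> {1..n}; j \<in> {1..n}; i < j\<rbrakk>
          \<Longrightarrow> d (\<phi> (g \<otimes> h) (xs i)) (\<phi> (g \<otimes> h) (xs j)) > \<delta>"
      using sens[OF F openin_mball] by metis
    \<comment> \<open>Every \<open>g\<close> in \<open>F\<close> keeps the coordinates of this
      translate apart, by the choice of \<open>h\<close>, while \<open>inv h\<close> returns them to
      a ball of radius \<epsilon>/2, which makes them pairwise near.\<close>
    define z where "z = power_action n \<phi> h xs"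
    have xsi: "xs i \<in> X" "d x (xs i) < \<epsilon>/2" if "i \<in> {1..n}" for i
      using PiE_mem[OF xs that] by auto
    have zi: "z i = \<phi> h (xs i)" "z i \<in> X" if "i \<in> {1..n}" for i
      using that xsi(1) act_in[OF h] by (auto simp: z_def power_action_def)
    have "z \<in> topspace (power_topology n mtopology)"
      unfolding topspace_power using zi(2) by (auto simp: z_def power_action_def)
    moreover have "\<delta> \<le> d (\<phi> g (z i)) (\<phi> g (z j))" if "g \<in> F" "i \<in> {1..n}" "j \<in> {i<..n}" for g i j
    proof -
      have "g \<in> carrier G" "j \<in> {1..n}" "i < j" using that F(2) by auto
      then show ?thesis
        using sep[of g i j] that zi(1) xsi(1) h by (simp add: composition_rule)
    qed
    moreover have "(z i, z j) \<in> pair_topology closure_of near_pairs \<epsilon>"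
      if ij: "i \<in> {1..n}" "j \<in> {1..n}" for i j
    proof -
      have "d (xs i) (xs j) \<le> d x (xs i) + d x (xs j)"
        using triangle'[of "xs i" x "xs j"] x xsi(1) ij commute by (metis add.commute)
      also have "\<dots> < \<epsilon>" using xsi(2)[OF ij(1)] xsi(2)[OF ij(2)] by simp
      finally have "d (\<phi> (inv h) (z i)) (\<phi> (inv h) (z j)) < \<epsilon>"
        using zi(1) ij xsi(1) h flow.inv_act by simp
      moreover have "inv h \<in> carrier G"
        using h by (rule flow.inv_closed)
      ultimately have "(z i, z j) \<in> near_pairs \<epsilon>"
        unfolding near_pairs_def using zi(2) ij by auto
      moreover have "near_pairs \<epsilon> \<subseteq> topspace pair_topology"
        by (auto simp: near_pairs_def)
      ultimately show ?thesis using closure_of_subset by blast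
    qed
    ultimately have "z \<in> K (F, \<epsilon>)"
      by (simp add: K_def separated_tuples_def)
    then show ?thesis by blast
  qed
  have "\<Inter>(K ` I) \<noteq> {}"
  proof (rule compact_space_directed_Inter[OF P.compact])
    have "({}, 1) \<in> I" by (simp add: I_def)
    then show "K ` I \<noteq> {}" by blast
    show "closedin (power_topology n mtopology) C \<and> C \<noteq> {}" if "C \<in> K ` I" for C
    proof -
      obtain F \<epsilon> where F: "finite F" "F \<subseteq> carrier G" "\<epsilon> > 0" "C = K (F, \<epsilon>)"
        using \<open>C \<in> K ` I\<close> by (auto simp: I_def)
      then have "closedin (power_topology n mtopology) C"
        by (simp add: K_def closedin_separated_tuples)
      then show ?thesis using K_ne F by simp
    qed
    fix A B assume "A \<in> K ` I" "B \<in> K ` I"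
    then obtain F1 \<epsilon>1 F2 \<epsilon>2 where i: "(F1, \<epsilon>1) \<in> I" "(F2, \<epsilon>2) \<in> I"
      and AB: "A = K (F1, \<epsilon>1)" "B = K (F2, \<epsilon>2)" by force
    \<comment> \<open>Stages shrink as \<open>F\<close> grows and \<epsilon> decreases, so the union
      and the minimum give a common refinement.\<close>
    let ?\<epsilon> = "min \<epsilon>1 \<epsilon>2"
    have "pair_topology closure_of near_pairs ?\<epsilon> \<subseteq> pair_topology closure_of near_pairs \<epsilon>1"
      "pair_topology closure_of near_pairs ?\<epsilon> \<subseteq> pair_topology closure_of near_pairs \<epsilon>2"
      by (intro closure_of_mono near_pairs_mono; simp)+
    then have "K (F1 \<union> F2, ?\<epsilon>) \<subseteq> A \<inter> B"
      unfolding K_def AB separated_tuples_def by auto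
    moreover have "(F1 \<union> F2, ?\<epsilon>) \<in> I" using i by (auto simp: I_def)
    ultimately show "\<exists>C\<in>K ` I. C \<subseteq> A \<inter> B" by blast
  qed
  then obtain z where z: "z \<in> K (F, \<epsilon>)" if "finite F" "F \<subseteq> carrier G" "\<epsilon> > 0" for F \<epsilon>
    unfolding I_def by fastforce
  let ?N = "separated_tuples n \<delta> (carrier G) (regionally_proximal G X d \<phi>)"
  have N_iff: "y \<in> ?N \<longleftrightarrow> y \<in> {1..n} \<rightarrow>\<^sub>E X \<and>
      (\<forall>g\<in>carrier G. \<forall>i\<in>{1..n}. \<forall>j\<in>{i<..n}. \<delta> \<le> d (\<phi> g (y i)) (\<phi> g (y j))) \<and>
      (\<forall>i\<in>{1..n}. \<forall>j\<in>{1..n}. (y i, y j) \<in> regionally_proximal G X d \<phi>)" for y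
    unfolding separated_tuples_def topspace_power by simp
  have "z \<in> ?N"
    unfolding N_iff
  proof (intro conjI ballI)
    show "z \<in> {1..n} \<rightarrow>\<^sub>E X"
      using z[of "{}" 1] unfolding K_def separated_tuples_def topspace_power by simp
    show "\<delta> \<le> d (\<phi> g (z i)) (\<phi> g (z j))" if "g \<in> carrier G" "i \<in> {1..n}" "j \<in> {i<..n}" for g i j
      using z[of "{g}" 1] that unfolding K_def separated_tuples_def by simp
    show "(z i, z j) \<in> regionally_proximal G X d \<phi>" if "i \<in> {1..n}" "j \<in> {1..n}" for i j
      using z[of "{}"] that unfolding K_def separated_tuples_def regionally_proximal_eq by simp
  qed
  \<comment> \<open>Separation along the whole group is what makes the set invariant: the bound at
    \<open>g\<close> for the translate is the bound at \<open>g \<otimes> h\<close> for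
    \<open>y\<close>.\<close>
  moreover have "power_action n \<phi> h y \<in> ?N" if h: "h \<in> carrier G" and y: "y \<in> ?N" for h y
  proof -
    have yi: "y i \<in> X" if "i \<in> {1..n}" for i
      using y that unfolding N_iff by (blast dest: PiE_mem)
    have act: "power_action n \<phi> h y i = \<phi> h (y i)" if "i \<in> {1..n}" for i
      using that by (simp add: power_action_def)
    show ?thesis
      unfolding N_iff
    proof (intro conjI ballI)
      show "power_action n \<phi> h y \<in> {1..n} \<rightarrow>\<^sub>E X"
        unfolding power_action_def using yi h act_in by auto
      show "\<delta> \<le> d (\<phi> g (power_action n \<phi> h y i)) (\<phi> g (power_action n \<phi> h y j))"
        if "g \<in> carrier G" "i \<in> {1..n}" "j \<in> {i<..n}" for g i j
      proof -
        have j: "j \<in> {1..n}" using that by auto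
        have "\<delta> \<le> d (\<phi> (g \<otimes> h) (y i)) (\<phi> (g \<otimes> h) (y j))"
          using y that h unfolding N_iff by blast
        then show ?thesis
          using act[OF that(2)] act[OF j] yi[OF that(2)] yi[OF j] that(1) h
          by (simp add: composition_rule)
      qed
      show "(power_action n \<phi> h y i, power_action n \<phi> h y j) \<in> regionally_proximal G X d \<phi>"
        if "i \<in> {1..n}" "j \<in> {1..n}" for i j
        using regionally_proximal_invariant[OF h, of "(y i, y j)"] y that act
        unfolding N_iff pair_action_def by simp
    qed
  qed
  ultimately have "subsystem G (power_topology n mtopology) (power_action n \<phi>) ?N"
    using closedin_separated_tuples[OF subset_refl closedin_regionally_proximal]
    unfolding subsystem_def by blast
  then obtain M where M: "minimal_set G (power_topology n mtopology) (power_action n \<phi>) M" "M \<subseteq> ?N"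
    by (rule P.ex_minimal_set)
  then obtain y where y: "y \<in> M" unfolding minimal_set_def subsystem_def by blast
  then have yN: "y \<in> ?N" using M(2) by blast
  then have yX: "y i \<in> X" if "i \<in> {1..n}" for i
    using that unfolding N_iff by (blast dest: PiE_mem)
  have ext: "y \<in> extensional {1..n}" using yN unfolding N_iff by (simp add: PiE_def)
  have 1: "1 \<in> {1..n}" using n by simp
  have "y \<in> {1..n} \<rightarrow>\<^sub>E (regionally_proximal G X d \<phi> `` {y 1})"
    using ext yN 1 unfolding N_iff by (simp add: PiE_def Pi_def)
  moreover have "inj_on y {1..n}"
  proof (rule linorder_inj_onI')
    fix i j assume ij: "i \<in> {1..n}" "j \<in> {1..n}" "i < j"
    then have "\<delta> \<le> d (\<phi> \<one> (y i)) (\<phi> \<one> (y j))"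
      using yN unfolding N_iff by (auto intro: flow.one_closed)
    then show "y i \<noteq> y j" using \<delta> ij yX flow.one_act by auto
  qed
  moreover have "minimal_point G (power_topology n mtopology) (power_action n \<phi>) y"
    using M(1) y unfolding minimal_point_iff by blast
  ultimately show ?thesis using yX[OF 1] by blast
qed

section \<open>Simultaneous return of regionally proximal points\<close>

lemma minimal_set_space:
  assumes "minimal_system G mtopology \<phi>"
  shows "minimal_set G mtopology \<phi> X"
proof -
  have "subsystem G mtopology \<phi> X"
    using nonempty act_in closedin_topspace[of mtopology] by (simp add: subsystem_def)
  moreover have "C = X" if "subsystem G mtopology \<phi> C" for C
    using minimal_system_subsystem_eq[OF assms that] by simp
  ultimately show ?thesis by (simp add: minimal_set_def)
qed

text \<open>The induction adds one closed invariant relation \<open>R i\<close> per coordinate. Only pairs of points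
  are assumed to be approximated by minimal points, so the tuples \<open>(q, y 1, \<dots>, y k)\<close> are controlled
  through the pairs \<open>(q, y i)\<close>: every tuple in the fibre product of the \<open>R i\<close> over \<open>q\<close> can be
  moved into \<open>U\<close>. The relation \<open>R (k + 1)\<close> is the orbit closure of a minimal pair that some group
  element brings so close together that \<open>y (k + 1)\<close> follows \<open>q\<close> under the finitely many
  group elements used before; by minimality this holds for all pairs in \<open>R (k + 1)\<close>.\<close>

lemma regionally_proximal_simultaneous_return:
  fixes V :: "nat \<Rightarrow> 'a set" and k :: nat
  assumes min: "minimal_system G mtopology \<phi>"
    and dense: "pair_topology closure_of
      {p. minimal_point G pair_topology (pair_action \<phi>) p} = X \<times> X"
    and A0: "openin mtopology A0" "A0 \<noteq> {}"
    and V: "\<And>i. i \<in> {1..k} \<Longrightarrow> openin mtopology (V i)"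
    and Q: "\<And>q i. q \<in> A0 \<Longrightarrow> i \<in> {1..k} \<Longrightarrow> \<exists>z\<in>V i. (q, z) \<in> regionally_proximal G X d \<phi>"
    and U: "openin mtopology U" "U \<noteq> {}"
  obtains R A F where "openin mtopology A" "A \<noteq> {}" "A \<subseteq> A0" "finite F" "F \<subseteq> carrier G"
    and "\<forall>i\<in>{1..k}. R i \<subseteq> X \<times> X"
    and "\<forall>i\<in>{1..k}. \<forall>g\<in>carrier G. \<forall>p\<in>R i. pair_action \<phi> g p \<in> R i"
    and "\<forall>q\<in>A. \<forall>i\<in>{1..k}. \<exists>y\<in>V i. (q, y) \<in> R i"
    and "\<forall>q\<in>X. \<forall>y. (\<forall>i\<in>{1..k}. (q, y i) \<in> R i)
      \<longrightarrow> (\<exists>g\<in>F. \<phi> g q \<in> U \<and> (\<forall>i\<in>{1..k}. \<phi> g (y i) \<in> U))"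
  using V Q U
proof (induction k arbitrary: U thesis)
  case 0
  \<comment> \<open>Without coordinates only \<open>q\<close> has to reach \<open>U\<close>, which
    is syndetic return in the minimal space \<open>X\<close>.\<close>
  have "X \<inter> U \<noteq> {}" using 0(4,5) openin_subset by fastforce
  then obtain F where "finite F" "F \<subseteq> carrier G" "\<forall>x\<in>X. \<exists>g\<in>F. \<phi> g x \<in> U"
    by (rule flow.minimal_set_finite_cover[OF minimal_set_space[OF min] 0(4)])
  then show ?case
    using A0 by (intro 0(1)[of A0 F "\<lambda>_. {}"]) auto
next
  case (Suc k)
  interpret P: compact_flow G pair_topology "pair_action \<phi>"
    by (rule compact_flow_pair) (rule flow.compact_flow_axioms)
  let ?k = "Suc k"
  obtain x where x: "x \<in> U" "x \<in> X" using Suc.prems(4,5) openin_subset by fastforce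
  then obtain r where r: "r > 0" "mball x r \<subseteq> U"
    using Suc.prems(4) unfolding openin_mtopology by blast
  have ne: "mball x (r/2) \<noteq> {}" using x(2) r(1) by (metis centre_in_mball_iff empty_iff half_gt_zero)
  \<comment> \<open>The induction hypothesis is used for the half-radius ball, leaving room of
    \<open>r/2\<close> for the new coordinate.\<close>
  obtain R A F where A: "openin mtopology A" "A \<noteq> {}" "A \<subseteq> A0"
    and F: "finite F" "F \<subseteq> carrier G"
    and R_sub: "\<forall>i\<in>{1..k}. R i \<subseteq> X \<times> X"
    and R_inv: "\<forall>i\<in>{1..k}. \<forall>g\<in>carrier G. \<forall>p\<in>R i. pair_action \<phi> g p \<in> R i"
    and R_V: "\<forall>q\<in>A. \<forall>i\<in>{1..k}. \<exists>y\<in>V i. (q, y) \<in> R i"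
    and R_F: "\<forall>q\<in>X. \<forall>y. (\<forall>i\<in>{1..k}. (q, y i) \<in> R i)
      \<longrightarrow> (\<exists>g\<in>F. \<phi> g q \<in> mball x (r/2) \<and> (\<forall>i\<in>{1..k}. \<phi> g (y i) \<in> mball x (r/2)))"
  proof (rule Suc.IH[OF _ _ _ openin_mball ne])
    show "openin mtopology (V i)" if "i \<in> {1..k}" for i using Suc.prems(2)[of i] that by simp
    show "\<exists>z\<in>V i. (q, z) \<in> regionally_proximal G X d \<phi>" if "q \<in> A0" "i \<in> {1..k}" for q i
      using Suc.prems(3)[of q i] that by simp
  qed
  \<comment> \<open>This choice depends on the finite set \<open>F\<close> just obtained: points
    closer than \<epsilon> remain within \<open>r/2\<close> under all of \<open>F\<close>.\<close>
  obtain \<epsilon> where \<epsilon>: "\<epsilon> > 0"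
    "\<forall>g\<in>F. \<forall>a\<in>X. \<forall>b\<in>X. d a b < \<epsilon> \<longrightarrow> d (\<phi> g a) (\<phi> g b) < r/2"
    by (rule uniformly_continuous_act[OF F half_gt_zero[OF r(1)]])
  have Vk: "openin mtopology (V ?k)" using Suc.prems(2)[of ?k] by simp
  \<comment> \<open>Nonempty because a regionally proximal pair in \<open>A \<times> V ?k\<close> is
    a limit of near pairs. As \<open>W\<close> is open, it contains a minimal pair by
    density.\<close>
  define W where "W = near_pairs \<epsilon> \<inter> A \<times> V ?k"
  have W: "openin pair_topology W"
    unfolding W_def using A(1) Vk
    by (intro openin_Int openin_near_pairs) (simp add: openin_prod_Times_iff)
  have "W \<noteq> {}"
  proof -
    obtain q where q: "q \<in> A" using A(2) by blast
    obtain z where z: "z \<in> V ?k" "(q, z) \<in> regionally_proximal G X d \<phi>"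
      using Suc.prems(3)[of q ?k] q A(3) by auto
    have "(q, z) \<in> pair_topology closure_of near_pairs \<epsilon>"
      using z(2) \<epsilon>(1) unfolding regionally_proximal_eq by simp
    then have "\<exists>p. p \<in> near_pairs \<epsilon> \<and> p \<in> A \<times> V ?k"
      using q z(1) A(1) Vk
      by (intro in_closure_of[THEN iffD1, THEN conjunct2, rule_format, of _ pair_topology] conjI)
        (auto simp: openin_prod_Times_iff)
    then show ?thesis by (auto simp: W_def)
  qed
  then obtain p0 where p0: "p0 \<in> W" by blast
  then have "p0 \<in> pair_topology closure_of {p. minimal_point G pair_topology (pair_action \<phi>) p}"
    unfolding dense W_def near_pairs_def by blast
  then obtain p where p: "minimal_point G pair_topology (pair_action \<phi>) p" "p \<in> W"
    using W p0 unfolding in_closure_of by blast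
  then obtain B where B: "minimal_set G pair_topology (pair_action \<phi>) B" "p \<in> B"
    unfolding minimal_point_iff by blast
  then have BW: "B \<inter> W \<noteq> {}" using p(2) by blast
  have B_inv: "pair_action \<phi> g p \<in> B" if "g \<in> carrier G" "p \<in> B" for g p
    using B(1) that by (simp add: minimal_set_def subsystem_def)
  \<comment> \<open>Nearness spreads from \<open>p\<close> to all of \<open>B\<close>, since
    \<open>near_pairs\<close> is open and invariant.\<close>
  have B_near: "B \<subseteq> near_pairs \<epsilon>"
    using B(2) p(2) near_pairs_invariant
    by (intro P.minimal_set_subset_open[OF B(1) openin_near_pairs]) (auto simp: W_def)
  then have B_sub: "B \<subseteq> X \<times> X" by (auto simp: near_pairs_def)
  \<comment> \<open>Projecting to the first coordinate gives an open set of \<open>q\<close>, inside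
    \<open>A\<close>, each of which has a \<open>B\<close>-partner in \<open>V ?k\<close>.\<close>
  obtain A' where A': "openin mtopology A'" "A' \<noteq> {}" "A' \<subseteq> fst ` (B \<inter> W)"
  proof (rule P.minimal_set_image_interior[OF flow.compact_flow_axioms min _ B(1) W BW
        continuous_map_fst])
    show "topspace mtopology \<noteq> {}" using nonempty by simp
    show "fst (pair_action \<phi> g p) = \<phi> g (fst p)" for g p by (simp add: pair_action_def)
  qed
  \<comment> \<open>The pairs already closer than \<epsilon>, written with the identity element so
    that \<open>openin_dist_act\<close> applies.\<close>
  define C where "C = {p \<in> X \<times> X. d (\<phi> \<one> (fst p)) (\<phi> \<one> (snd p)) < \<epsilon>}"
  have C_open: "openin pair_topology C"
    unfolding C_def by (rule openin_dist_act[OF flow.one_closed])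
  obtain h0 where h0: "h0 \<in> carrier G" "d (\<phi> h0 (fst p)) (\<phi> h0 (snd p)) < \<epsilon>"
    using B_near B(2) by (auto simp: near_pairs_def)
  have "pair_action \<phi> h0 p \<in> B" using B_inv h0(1) B(2) by blast
  moreover have "pair_action \<phi> h0 p \<in> C"
    using h0 B_sub B(2) flow.one_act act_in[OF h0(1)]
    unfolding C_def pair_action_def by auto
  ultimately have "B \<inter> C \<noteq> {}" by blast
  then obtain H where H: "finite H" "H \<subseteq> carrier G" "\<forall>p\<in>B. \<exists>h\<in>H. pair_action \<phi> h p \<in> C"
    by (rule P.minimal_set_finite_cover[OF B(1) C_open])
  let ?R = "R(?k := B)"
  \<comment> \<open>First \<open>h\<close> brings \<open>q\<close> and the new coordinate close
    while invariance keeps the other pairs in their \<open>R i\<close>; then \<open>g\<close> moves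
    the translated tuple into the ball, with the new coordinate following \<open>q\<close>.\<close>
  let ?F = "(\<lambda>(g, h). g \<otimes> h) ` (F \<times> H)"
  show ?case
  proof (rule Suc.prems(1))
    show "openin mtopology A'" "A' \<noteq> {}" by fact+
    have A'A: "A' \<subseteq> A" using A'(3) by (auto simp: W_def)
    then show "A' \<subseteq> A0" using A(3) by blast
    show "finite ?F" using F(1) H(1) by simp
    show "?F \<subseteq> carrier G" using F(2) H(2) flow.m_closed by auto
    show "\<forall>i\<in>{1..?k}. ?R i \<subseteq> X \<times> X"
      using R_sub B_sub by simp
    show "\<forall>i\<in>{1..?k}. \<forall>g\<in>carrier G. \<forall>p\<in>?R i. pair_action \<phi> g p \<in> ?R i"
      using R_inv B_inv by simp
    have "\<exists>y\<in>V i. (q, y) \<in> ?R i" if qi: "q \<in> A'" "i \<in> {1..?k}" for q i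
    proof (cases "i = ?k")
      case True
      obtain p where "p \<in> B" "p \<in> W" "q = fst p" using A'(3) qi(1) by blast
      then show ?thesis using True by (intro bexI[of _ "snd p"]) (auto simp: W_def)
    next
      case False
      then have "i \<in> {1..k}" using that(2) by simp
      moreover have "q \<in> A" using that(1) A'A by blast
      ultimately show ?thesis using False R_V by simp
    qed
    then show "\<forall>q\<in>A'. \<forall>i\<in>{1..?k}. \<exists>y\<in>V i. (q, y) \<in> ?R i" by blast
    show "\<forall>q\<in>X. \<forall>y. (\<forall>i\<in>{1..?k}. (q, y i) \<in> ?R i)
      \<longrightarrow> (\<exists>g\<in>?F. \<phi> g q \<in> U \<and> (\<forall>i\<in>{1..?k}. \<phi> g (y i) \<in> U))"
    proof (intro ballI allI impI)
      fix q y assume q: "q \<in> X" and y: "\<forall>i\<in>{1..?k}. (q, y i) \<in> ?R i"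
      have yk: "(q, y ?k) \<in> B" using y[rule_format, of ?k] by simp
      have yi: "(q, y i) \<in> R i" if "i \<in> {1..k}" for i
        using y[rule_format, of i] that by simp
      have yX: "y i \<in> X" if "i \<in> {1..?k}" for i
      proof (cases "i = ?k")
        case False
        then have "i \<in> {1..k}" using that by simp
        then show ?thesis using yi R_sub by blast
      qed (use yk B_sub in auto)
      obtain h where h: "h \<in> H" "pair_action \<phi> h (q, y ?k) \<in> C" using H(3) yk by blast
      then have hG: "h \<in> carrier G" using H(2) by blast
      have dh: "d (\<phi> h q) (\<phi> h (y ?k)) < \<epsilon>"
        using h(2) flow.one_act unfolding C_def pair_action_def by auto
      have "\<forall>i\<in>{1..k}. (\<phi> h q, \<phi> h (y i)) \<in> R i"
      proof
        fix i assume i: "i \<in> {1..k}"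
        have "pair_action \<phi> h (q, y i) \<in> R i" using R_inv i hG yi[OF i] by blast
        then show "(\<phi> h q, \<phi> h (y i)) \<in> R i" by (simp add: pair_action_def)
      qed
      then obtain g where g: "g \<in> F" "\<phi> g (\<phi> h q) \<in> mball x (r/2)"
        "\<And>i. i \<in> {1..k} \<Longrightarrow> \<phi> g (\<phi> h (y i)) \<in> mball x (r/2)"
        using R_F[rule_format, OF act_in[OF hG q], of "\<lambda>i. \<phi> h (y i)"] by blast
      then have gG: "g \<in> carrier G" using F(2) by blast
      have gy: "\<phi> g (\<phi> h (y i)) \<in> mball x r" if i: "i \<in> {1..?k}" for i
      proof (cases "i = ?k")
        case True
        have "d (\<phi> g (\<phi> h q)) (\<phi> g (\<phi> h (y i))) < r/2"
          using \<epsilon>(2)[rule_format, OF g(1) _ _ dh] q yX[OF i] True act_in[OF hG] by simp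
        moreover have "d x (\<phi> g (\<phi> h q)) < r/2" using g(2) by simp
        moreover have "d x (\<phi> g (\<phi> h (y i)))
            \<le> d x (\<phi> g (\<phi> h q)) + d (\<phi> g (\<phi> h q)) (\<phi> g (\<phi> h (y i)))"
          using q x(2) yX[OF i] act_in[OF hG] act_in[OF gG] by (intro triangle) auto
        ultimately show ?thesis
          using x(2) yX[OF i] act_in[OF hG] act_in[OF gG] by simp
      next
        case False
        then show ?thesis using g(3)[of i] i r(1) by simp
      qed
      show "\<exists>g\<in>?F. \<phi> g q \<in> U \<and> (\<forall>i\<in>{1..?k}. \<phi> g (y i) \<in> U)"
      proof (intro bexI conjI ballI)
        show "g \<otimes> h \<in> ?F" using g(1) h(1) by force
        show "\<phi> (g \<otimes> h) q \<in> U"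
          using g(2) r gG hG q by (auto simp: composition_rule)
        show "\<phi> (g \<otimes> h) (y i) \<in> U" if "i \<in> {1..?k}" for i
          using gy[OF that] r(2) gG hG yX[OF that] by (auto simp: composition_rule)
      qed
    qed
  qed
qed

section \<open>From minimal tuples to sensitivity\<close>

text \<open>The orbit closure of \<open>xs\<close> is separated by some \<delta>. Points
  \<open>y i\<close> near \<open>xs i\<close> that a common \<open>h\<close> sends into
  \<open>U\<close> yield the required tuple in \<open>U\<close>: applying \<open>inv h\<close>
  recovers the \<open>y i\<close>, which stay close to the \<open>xs i\<close> under the given
  finite set \<open>F\<close>.\<close>

lemma minimal_tuple_imp_sensitive:
  assumes min: "minimal_system G mtopology \<phi>"
    and dense: "pair_topology closure_of
      {p. minimal_point G pair_topology (pair_action \<phi>) p} = X \<times> X"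
    and x: "x \<in> X" and xs: "xs \<in> {1..n} \<rightarrow>\<^sub>E (regionally_proximal G X d \<phi> `` {x})"
    and inj: "inj_on xs {1..n}"
    and mp: "minimal_point G (power_topology n mtopology) (power_action n \<phi>) xs"
  shows "blockily_thickly_sensitive n G X d \<phi>"
proof -
  interpret P: compact_flow G "power_topology n mtopology" "power_action n \<phi>"
    by (rule compact_flow_power) (rule flow.compact_flow_axioms)
  let ?act = "\<lambda>g p. (\<phi> g (fst p), power_action n \<phi> g (snd p))"
  let ?PT = "prod_topology mtopology (power_topology n mtopology)"
  interpret PP: compact_flow G ?PT ?act
    by (rule compact_flow_prod) unfold_locales
  let ?Q = "regionally_proximal G X d \<phi>"
  obtain M where M: "minimal_set G (power_topology n mtopology) (power_action n \<phi>) M" "xs \<in> M"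
    using mp unfolding minimal_point_iff by blast
  then have M': "closedin (power_topology n mtopology) M" "M \<subseteq> {1..n} \<rightarrow>\<^sub>E X"
    "\<And>g z. g \<in> carrier G \<Longrightarrow> z \<in> M \<Longrightarrow> power_action n \<phi> g z \<in> M"
    using closedin_subset[of _ M] unfolding minimal_set_def subsystem_def topspace_power[symmetric]
    by blast+
  obtain \<delta> where \<delta>: "\<delta> > 0"
    "\<And>z i j. z \<in> M \<Longrightarrow> i \<in> {1..n} \<Longrightarrow> j \<in> {1..n} \<Longrightarrow> i < j \<Longrightarrow> \<delta> \<le> d (z i) (z j)"
    using minimal_set_separated[OF M inj] by blast
  \<comment> \<open>Adjoining the base point gives a flow with equivariant projections to
    \<open>X\<close> and to the power, so open sets of tuples can be transferred to open sets of
    base points.\<close>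
  define N where "N = {p \<in> X \<times> M. \<forall>i\<in>{1..n}. (fst p, snd p i) \<in> ?Q}"
  have N_top: "N = {p \<in> topspace ?PT. p \<in> X \<times> M \<and> (\<forall>i\<in>{1..n}. (fst p, snd p i) \<in> ?Q)}"
    using M'(2) by (auto simp: N_def topspace_power)
  have "closedin ?PT N"
    unfolding N_top
  proof (intro closedin_Collect_conj closedin_Collect_ball)
    have "{p \<in> topspace ?PT. p \<in> X \<times> M} = X \<times> M"
      using M'(2) by (auto simp: topspace_power)
    moreover have "closedin ?PT (X \<times> M)"
      using M'(1) closedin_topspace[of mtopology] by (simp add: closedin_prod_Times_iff)
    ultimately show "closedin ?PT {p \<in> topspace ?PT. p \<in> X \<times> M}" by simp
    fix i assume i: "i \<in> {1..n}"
    have "continuous_map ?PT pair_topology (\<lambda>p. (fst p, snd p i))"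
      using continuous_map_compose[OF continuous_map_snd continuous_map_coordinate[OF i]]
      by (simp add: continuous_map_paired continuous_map_fst o_def)
    from closedin_continuous_map_preimage[OF this closedin_regionally_proximal]
    show "closedin ?PT {p \<in> topspace ?PT. (fst p, snd p i) \<in> ?Q}" .
  qed
  moreover have "(x, xs) \<in> N"
    using x M(2) xs by (auto simp: N_def)
  moreover have "?act g p \<in> N" if g: "g \<in> carrier G" and p: "p \<in> N" for g p
  proof -
    have "(\<phi> g (fst p), power_action n \<phi> g (snd p) i) \<in> ?Q" if "i \<in> {1..n}" for i
      using regionally_proximal_invariant[OF g, of "(fst p, snd p i)"] p that
      by (simp add: N_def power_action_def pair_action_def)
    then show ?thesis using p g act_in M'(3) by (auto simp: N_def)
  qed
  ultimately have "subsystem G ?PT ?act N" unfolding subsystem_def by blast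
  then obtain C where C: "minimal_set G ?PT ?act C" "C \<subseteq> N" by (rule PP.ex_minimal_set)
  \<comment> \<open>The minimal set \<open>C\<close> projects onto \<open>M\<close>, so it contains
    \<open>xs\<close> over some base point \<open>x'\<close>, which may differ from
    \<open>x\<close>.\<close>
  have "subsystem G (power_topology n mtopology) (power_action n \<phi>) (snd ` C)"
    using C(1) P.compact_flow_axioms
    by (intro PP.subsystem_image) (auto simp: minimal_set_def continuous_map_snd)
  moreover have "snd ` C \<subseteq> M" using C(2) by (auto simp: N_def)
  ultimately have "snd ` C = M" using M(1) by (simp add: minimal_set_def)
  then obtain x' where x': "(x', xs) \<in> C" using M(2) by force

  have main: "\<exists>ys \<in> {1..n} \<rightarrow>\<^sub>E U. \<exists>h\<in>carrier G. \<forall>g\<in>F. \<forall>i\<in>{1..n}. \<forall>j\<in>{1..n}.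
      i < j \<longrightarrow> d (\<phi> (g \<otimes> h) (ys i)) (\<phi> (g \<otimes> h) (ys j)) > \<delta>/3"
    if F: "finite F" "F \<subseteq> carrier G" and U: "openin mtopology U" "U \<noteq> {}" for F U
  proof -
    have xsX: "xs i \<in> X" if "i \<in> {1..n}" for i
      using M(2) M'(2) that by (meson PiE_mem subsetD)
    obtain \<epsilon> where \<epsilon>: "\<epsilon> > 0"
      "\<forall>g\<in>F. \<forall>a\<in>X. \<forall>b\<in>X. d a b < \<epsilon> \<longrightarrow> d (\<phi> g a) (\<phi> g b) < \<delta>/3"
      using uniformly_continuous_act[OF F, of "\<delta>/3"] \<delta>(1) by auto
    define V where "V = (\<lambda>i. mball (xs i) \<epsilon>)"
    have "openin (power_topology n mtopology) (PiE {1..n} V)"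
      unfolding power_topology_def openin_PiE_gen by (simp add: V_def)
    then have W: "openin ?PT (X \<times> PiE {1..n} V)"
      using openin_topspace[of mtopology] by (simp add: openin_prod_Times_iff)
    have "x' \<in> X" using x' C(2) by (auto simp: N_def)
    moreover have "xs \<in> PiE {1..n} V"
      using xs xsX \<epsilon>(1) by (auto simp: V_def PiE_iff)
    ultimately have CW: "C \<inter> (X \<times> PiE {1..n} V) \<noteq> {}" using x' by blast
    obtain A0 where A0: "openin mtopology A0" "A0 \<noteq> {}" "A0 \<subseteq> fst ` (C \<inter> (X \<times> PiE {1..n} V))"
    proof (rule PP.minimal_set_image_interior[OF flow.compact_flow_axioms min _ C(1) W CW
          continuous_map_fst])
      show "topspace mtopology \<noteq> {}" using nonempty by simp
    qed simp
    have A0_Q: "\<exists>z\<in>V i. (q, z) \<in> ?Q" if "q \<in> A0" "i \<in> {1..n}" for q i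
    proof -
      obtain p where p: "p \<in> C" "snd p \<in> PiE {1..n} V" "q = fst p" using A0(3) \<open>q \<in> A0\<close> by auto
      have "snd p i \<in> V i" using p(2) that(2) by (rule PiE_mem)
      moreover have "(q, snd p i) \<in> ?Q" using p C(2) that(2) by (auto simp: N_def)
      ultimately show ?thesis by blast
    qed
    have V_open: "openin mtopology (V i)" if "i \<in> {1..n}" for i by (simp add: V_def)
    obtain R A F' where A: "openin mtopology A" "A \<noteq> {}" and "A \<subseteq> A0" "finite F'"
      and F': "F' \<subseteq> carrier G"
      and "\<forall>i\<in>{1..n}. R i \<subseteq> X \<times> X"
      and "\<forall>i\<in>{1..n}. \<forall>g\<in>carrier G. \<forall>p\<in>R i. pair_action \<phi> g p \<in> R i"
      and R_V: "\<forall>q\<in>A. \<forall>i\<in>{1..n}. \<exists>y\<in>V i. (q, y) \<in> R i"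
      and R_F': "\<forall>q\<in>X. \<forall>y. (\<forall>i\<in>{1..n}. (q, y i) \<in> R i)
      \<longrightarrow> (\<exists>g\<in>F'. \<phi> g q \<in> U \<and> (\<forall>i\<in>{1..n}. \<phi> g (y i) \<in> U))"
      by (rule regionally_proximal_simultaneous_return[OF min dense A0(1,2) V_open A0_Q U])
    obtain q where q: "q \<in> A" "q \<in> X" using A openin_subset by fastforce
    obtain y where y: "\<And>i. i \<in> {1..n} \<Longrightarrow> y i \<in> V i \<and> (q, y i) \<in> R i"
      using R_V[rule_format, OF q(1)] by metis
    obtain h where h: "h \<in> F'" "\<And>i. i \<in> {1..n} \<Longrightarrow> \<phi> h (y i) \<in> U"
      using R_F'[rule_format, OF q(2), of y] y by blast
    then have hG: "h \<in> carrier G" using F' by blast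
    then have ihG: "inv h \<in> carrier G" by (rule flow.inv_closed)
    \<comment> \<open>The element demanded by sensitivity is \<open>inv h\<close>, since
      \<open>g \<otimes> inv h\<close> takes \<open>ys i\<close> to the translate of
      \<open>y i\<close> by \<open>g\<close>.\<close>
    define ys where "ys = (\<lambda>i\<in>{1..n}. \<phi> h (y i))"
    have yX: "y i \<in> X" "d (xs i) (y i) < \<epsilon>" if "i \<in> {1..n}" for i
      using y[OF that] by (auto simp: V_def)
    have ys: "\<phi> (g \<otimes> inv h) (ys i) = \<phi> g (y i)" if "g \<in> F" "i \<in> {1..n}" for g i
    proof -
      have "g \<in> carrier G" using that(1) F(2) by blast
      then show ?thesis
        using that yX(1)[OF that(2)] ihG hG act_in[OF hG] flow.inv_act[OF hG]
        by (simp add: ys_def composition_rule)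
    qed
    have "d (\<phi> g (y i)) (\<phi> g (y j)) > \<delta>/3"
      if g: "g \<in> F" and ij: "i \<in> {1..n}" "j \<in> {1..n}" "i < j" for g i j
    proof -
      have gG: "g \<in> carrier G" using g F(2) by blast
      have "power_action n \<phi> g xs \<in> M" using M'(3) gG M(2) by blast
      from \<delta>(2)[OF this ij] have "\<delta> \<le> d (\<phi> g (xs i)) (\<phi> g (xs j))"
        using ij by (simp add: power_action_def)
      moreover have "d (\<phi> g (xs i)) (\<phi> g (y i)) < \<delta>/3" "d (\<phi> g (xs j)) (\<phi> g (y j)) < \<delta>/3"
        using \<epsilon>(2)[rule_format, OF g] xsX yX ij by simp_all
      \<comment> \<open>Of the separation \<delta>, each of the two replacements of
        \<open>xs\<close> by \<open>y\<close> costs less than \<delta>/3, so more than \<delta>/3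
        remains.\<close>
      moreover have "d (\<phi> g (xs i)) (\<phi> g (xs j)) \<le> d (\<phi> g (xs i)) (\<phi> g (y i))
          + d (\<phi> g (y i)) (\<phi> g (y j)) + d (\<phi> g (xs j)) (\<phi> g (y j))"
      proof -
        have "\<phi> g (xs i) \<in> X" "\<phi> g (xs j) \<in> X" "\<phi> g (y i) \<in> X" "\<phi> g (y j) \<in> X"
          using xsX yX(1) ij act_in[OF gG] by auto
        then show ?thesis
          using triangle[of "\<phi> g (xs i)" "\<phi> g (y i)" "\<phi> g (xs j)"]
            triangle[of "\<phi> g (y i)" "\<phi> g (y j)" "\<phi> g (xs j)"]
            commute[of "\<phi> g (y j)" "\<phi> g (xs j)"] by linarith
      qed
      ultimately show ?thesis by linarith
    qed
    then have "\<forall>g\<in>F. \<forall>i\<in>{1..n}. \<forall>j\<in>{1..n}.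
        i < j \<longrightarrow> d (\<phi> (g \<otimes> inv h) (ys i)) (\<phi> (g \<otimes> inv h) (ys j)) > \<delta>/3"
      using ys by simp
    moreover have "ys \<in> {1..n} \<rightarrow>\<^sub>E U" using h(2) by (simp add: ys_def)
    ultimately show ?thesis using ihG by blast
  qed
  show ?thesis
    unfolding blockily_thickly_sensitive_def
  proof (intro exI conjI allI impI)
    show "\<delta>/3 > 0" using \<delta>(1) by simp
  qed (elim conjE, rule main)
qed

end

theorem theorem3:
  fixes G :: "('g, 'm) monoid_scheme"
    and X :: "'a set" and d :: "'a \<Rightarrow> 'a \<Rightarrow> real" and \<phi> :: "'g \<Rightarrow> 'a \<Rightarrow> 'a"
    and n :: nat
  defines "T \<equiv> Metric_space.mtopology X d"
  assumes "topological_dynamical_system G X d \<phi>"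
    and "minimal_system G T \<phi>"
    and "n \<ge> 2"
    and "prod_topology T T closure_of
           {p. minimal_point G (prod_topology T T) (pair_action \<phi>) p} = X \<times> X"
  shows "blockily_thickly_sensitive n G X d \<phi> \<longleftrightarrow>
    (\<exists>x\<in>X. \<exists>xs \<in> {1..n} \<rightarrow>\<^sub>E (regionally_proximal G X d \<phi> `` {x}).
       inj_on xs {1..n} \<and> minimal_point G (power_topology n T) (power_action n \<phi>) xs)"
proof -
  interpret topological_dynamical_system G X d \<phi> by (rule assms)
  note min = assms(3)[unfolded T_def] and dense = assms(5)[unfolded T_def]
  show ?thesis
    unfolding T_def
  proof
    assume "blockily_thickly_sensitive n G X d \<phi>"
    then show "\<exists>x\<in>X. \<exists>xs \<in> {1..n} \<rightarrow>\<^sub>E (regionally_proximal G X d \<phi> `` {x}).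
        inj_on xs {1..n} \<and> minimal_point G (power_topology n mtopology) (power_action n \<phi>) xs"
      using \<open>n \<ge> 2\<close> by (rule sensitive_imp_minimal_tuple)
  next
    assume "\<exists>x\<in>X. \<exists>xs \<in> {1..n} \<rightarrow>\<^sub>E (regionally_proximal G X d \<phi> `` {x}).
        inj_on xs {1..n} \<and> minimal_point G (power_topology n mtopology) (power_action n \<phi>) xs"
    then show "blockily_thickly_sensitive n G X d \<phi>"
      by (elim bexE conjE) (rule minimal_tuple_imp_sensitive[OF min dense])
  qed
qed

end
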